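(* Let $f$ be convex and let $g$ be anisotropically strongly convex with constant $\mu>0$ relative to $\phi_-$. Let $\{y^k\}_{k=0}^\infty$ be the sequence of forward-steps generated by the anisotropic proximal gradient method with step-size $\lambda=1/L$. Then $$G:=(g\,\square\,(\lambda\star\phi_-))+(f\boxminus(\lambda\star\phi))$$ has a unique minimizer $y^\star$ and $\{G(y^k)\}_{k=0}^\infty$ converges $Q$-linearly to $G(y^\star)$; in particular, for all $k\ge0$ $$G(y^{k+1})-G(y^\star)\le\big(1-\tfrac{\mu}{\mu+L}\big)\big(G(y^k)-G(y^\star)\big).$$
   Context: $\Gamma_0(\mathbb{R}^n)$: proper lower semicontinuous convex functions $\mathbb{R}^n\to\overline{\mathbb{R}}$. Reference function: $\phi\in\Gamma_0(\mathbb{R}^n)$ has $\operatorname{dom}\phi=\mathbb{R}^n$ and is Legendre (essentially smooth and essentially strictly convex in the sense of Rockafellar); so $\nabla\phi:\mathbb{R}^n\to\operatorname{int}\operatorname{dom}\phi^*$ is a bijection with inverse $\nabla\phi^*$ ($\phi^*$ the convex conjugate). $\phi_-(x):=\phi(-x)$ and $\phi_-^*:=(\phi_-)^*=\phi^*(-\,\cdot)$. For $\lambda>0$, $(\lambda\star h)(x)=\lambda h(\lambda^{-1}x)$. Infimal convolution: $(g\,\square\,h)(x)=\inf_{y}\{h(x-y)+g(y)\}$. Infimal deconvolution: $(f\boxminus h)(x)=\sup_{u\in\mathbb{R}^n}\{f(x+u)-h(u)\}$. $\operatorname{rge}$ denotes the range. Standing assumptions: $f\in\mathcal{C}^1(\mathbb{R}^n)$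 has the anisotropic descent property relative to $\phi$ with constant $L>0$, i.e., $\operatorname{rge}\nabla f\subseteq\operatorname{rge}\nabla\phi$ and for all $\bar x,x\in\mathbb{R}^n$ $$f(x)\le f(\bar x)+\tfrac1L\star\phi\big(x-\bar x+L^{-1}\nabla\phi^*(\nabla f(\bar x))\big)-\tfrac1L\star\phi\big(L^{-1}\nabla\phi^*(\nabla f(\bar x))\big);$$ $g:\mathbb{R}^n\to\overline{\mathbb{R}}$ is proper lower semicontinuous; $F:=f+g$ satisfies $\inf F>-\infty$; and, $g$ being convex here, $\operatorname{dom}g^*\cap\operatorname{int}(\operatorname{dom}\phi_-^* )\ne\emptyset$. Anisotropic strong convexity of $h\in\Gamma_0(\mathbb{R}^n)$ relative to a (full-domain Legendre) function $\varphi$ with constant $\mu>0$: $\operatorname{rge}\partial h\supseteq\operatorname{rge}\nabla\varphi$ and for all $(\bar x,\bar v)\in\operatorname{gph}\partial h\cap(\mathbb{R}^n\times\operatorname{int}\operatorname{dom}\varphi^* )$ $$h(x)\ge h(\bar x)+\tfrac1\mu\star\varphi\big(x-\bar x+\mu^{-1}\nabla\varphi^*(\bar v)\big)-\tfrac1\mu\star\varphi\big(\mu^{-1}\nabla\varphi^*(\bar v)\big)\quad\forall x\in\mathbb{R}^n.$$ Anisotropic proximal gradient method with step-size $\lambda$: starting from $x^0\in\mathbb{R}^n$, for $k=0,1,\ldots$ $$y^k=x^k-\lambda\nabla\phi^*(\nabla f(x^k))\ \ (\text{forward-step}),\qquad x^{k+1}\in\operatorname*{arg\,min}_{x\in\mathbb{R}^n}\{g(x)+\lambda\star\phi(x-y^k)\}\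 \ (\text{backward-step}).$$ A sequence $\{a_k\}$ converges $Q$-linearly to $a$ with rate $\rho$ if $\lim_{k\to\infty}\frac{|a_{k+1}-a|}{|a_k-a|}\le\rho$.
   Formalization: Q-linear convergence is stated as convergence together with limsup (not lim) of the quotients at most 1 − μ/(μ+L), with 0/0 read as 0, since the limit of the quotients need not exist and the quotient is 0/0 once the minimal value is reached. *)

theory Defs
  imports "HOL-Analysis.Analysis"
begin

text \<open>Pitfall: in \<^typ>\<open>ereal\<close>, \<open>\<infinity> + -\<infinity> = \<infinity>\<close> and \<open>\<infinity> - \<infinity> = \<infinity>\<close>. Below, sums and differences
  are only formed where at least one side is finite, or where no term is \<open>-\<infinity>\<close>.\<close>

definition edom :: "('a \<Rightarrow> ereal) \<Rightarrow> 'a set" where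
  "edom h = {x. h x < \<infinity>}"

definition proper_fun :: "('a \<Rightarrow> ereal) \<Rightarrow> bool" where
  "proper_fun h \<longleftrightarrow> (\<forall>x. h x > -\<infinity>) \<and> edom h \<noteq> {}"

definition lsc :: "('a::topological_space \<Rightarrow> ereal) \<Rightarrow> bool" where
  "lsc h \<longleftrightarrow> (\<forall>x. h x \<le> Liminf (at x) h)"

definition convex_fun :: "('a::real_vector \<Rightarrow> ereal) \<Rightarrow> bool" where
  "convex_fun h \<longleftrightarrow> convex {(x, t::real). h x \<le> ereal t}"

definition Gamma0 :: "('a::euclidean_space \<Rightarrow> ereal) set" where
  "Gamma0 = {h. proper_fun h \<and> lsc h \<and> convex_fun h}"

definition convex_conjugate :: "('a::euclidean_space \<Rightarrow> ereal) \<Rightarrow> 'a \<Rightarrow> ereal" where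
  "convex_conjugate h v = (SUP x. ereal (v \<bullet> x) - h x)"

text \<open>For proper \<open>h\<close> this set is empty at points outside \<open>edom h\<close>.\<close>

definition subdifferential :: "('a::euclidean_space \<Rightarrow> ereal) \<Rightarrow> 'a \<Rightarrow> 'a set" where
  "subdifferential h x = {v. \<forall>y. h x + ereal (v \<bullet> (y - x)) \<le> h y}"

definition gradient :: "('a::euclidean_space \<Rightarrow> real) \<Rightarrow> 'a \<Rightarrow> 'a" where
  "gradient f x = (THE v. GDERIV f x :> v)"

definition C1_fun :: "('a::euclidean_space \<Rightarrow> real) \<Rightarrow> bool" where
  "C1_fun f \<longleftrightarrow> (\<forall>x. f differentiable (at x)) \<and> continuous_on UNIV (gradient f)"

text \<open>The gradient of an extended-real-valued function is only meaningful on the interior of its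
  effective domain, because \<^const>\<open>real_of_ereal\<close> sends \<open>\<infinity>\<close> to \<open>0\<close>.\<close>

definition egradient :: "('a::euclidean_space \<Rightarrow> ereal) \<Rightarrow> 'a \<Rightarrow> 'a" where
  "egradient h = gradient (\<lambda>x. real_of_ereal (h x))"

definition essentially_smooth :: "('a::euclidean_space \<Rightarrow> ereal) \<Rightarrow> bool" where
  "essentially_smooth h \<longleftrightarrow>
     proper_fun h \<and> convex_fun h \<and>
     interior (edom h) \<noteq> {} \<and>
     (\<forall>x\<in>interior (edom h). (\<lambda>z. real_of_ereal (h z)) differentiable (at x)) \<and>
     (\<forall>X x. (\<forall>i. X i \<in> interior (edom h)) \<and> X \<longlonglongrightarrow> x \<and> x \<in> frontier (interior (edom h)) \<longrightarrow>
        filterlim (\<lambda>i. norm (egradient h (X i))) at_top sequentially)"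

definition strictly_convex_fun_on :: "'a::real_vector set \<Rightarrow> ('a \<Rightarrow> ereal) \<Rightarrow> bool" where
  "strictly_convex_fun_on S h \<longleftrightarrow>
     (\<forall>x\<in>S. \<forall>y\<in>S. \<forall>t::real. x \<noteq> y \<and> 0 < t \<and> t < 1 \<longrightarrow>
        h ((1 - t) *\<^sub>R x + t *\<^sub>R y) < ereal (1 - t) * h x + ereal t * h y)"

definition essentially_strictly_convex :: "('a::euclidean_space \<Rightarrow> ereal) \<Rightarrow> bool" where
  "essentially_strictly_convex h \<longleftrightarrow>
     proper_fun h \<and> convex_fun h \<and>
     (\<forall>S. convex S \<and> S \<subseteq> {x. subdifferential h x \<noteq> {}} \<longrightarrow> strictly_convex_fun_on S h)"

definition legendre :: "('a::euclidean_space \<Rightarrow> ereal) \<Rightarrow> bool" where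
  "legendre h \<longleftrightarrow> essentially_smooth h \<and> essentially_strictly_convex h"

definition reference_function :: "('a::euclidean_space \<Rightarrow> ereal) \<Rightarrow> bool" where
  "reference_function \<phi> \<longleftrightarrow> \<phi> \<in> Gamma0 \<and> edom \<phi> = UNIV \<and> legendre \<phi>"

definition reflect :: "('a::uminus \<Rightarrow> ereal) \<Rightarrow> 'a \<Rightarrow> ereal" where
  "reflect h x = h (- x)"

definition episcale :: "real \<Rightarrow> ('a::real_vector \<Rightarrow> ereal) \<Rightarrow> 'a \<Rightarrow> ereal"  (infixr "\<star>" 75) where
  "(c \<star> h) x = ereal c * h (inverse c *\<^sub>R x)"

definition inf_conv :: "('a::real_vector \<Rightarrow> ereal) \<Rightarrow> ('a \<Rightarrow> ereal) \<Rightarrow> 'a \<Rightarrow> ereal"  (infixl "\<box>" 70) where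
  "(g \<box> h) x = (INF y. h (x - y) + g y)"

definition inf_deconv :: "('a::real_vector \<Rightarrow> ereal) \<Rightarrow> ('a \<Rightarrow> ereal) \<Rightarrow> 'a \<Rightarrow> ereal"  (infixl "\<boxminus>" 70) where
  "(f \<boxminus> h) x = (SUP u. f (x + u) - h u)"

definition argmin :: "('a \<Rightarrow> ereal) \<Rightarrow> 'a set" where
  "argmin h = {x. is_arg_min h (\<lambda>_. True) x}"

definition aniso_descent :: "('a::euclidean_space \<Rightarrow> ereal) \<Rightarrow> real \<Rightarrow> ('a \<Rightarrow> real) \<Rightarrow> bool" where
  "aniso_descent \<phi> L f \<longleftrightarrow>
     range (gradient f) \<subseteq> range (egradient \<phi>) \<and>
     (\<forall>xb x. let d = inverse L *\<^sub>R egradient (convex_conjugate \<phi>) (gradient f xb) in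
        ereal (f x) \<le> ereal (f xb) + ((1 / L) \<star> \<phi>) (x - xb + d) - ((1 / L) \<star> \<phi>) d)"

definition aniso_strongly_convex :: "('a::euclidean_space \<Rightarrow> ereal) \<Rightarrow> real \<Rightarrow> ('a \<Rightarrow> ereal) \<Rightarrow> bool" where
  "aniso_strongly_convex \<phi> \<mu> h \<longleftrightarrow>
     h \<in> Gamma0 \<and>
     range (egradient \<phi>) \<subseteq> (\<Union>x. subdifferential h x) \<and>
     (\<forall>xb vb. vb \<in> subdifferential h xb \<and> vb \<in> interior (edom (convex_conjugate \<phi>)) \<longrightarrow>
        (let d = inverse \<mu> *\<^sub>R egradient (convex_conjugate \<phi>) vb in
           \<forall>x. h xb + ((1 / \<mu>) \<star> \<phi>) (x - xb + d) - ((1 / \<mu>) \<star> \<phi>) d \<le> h x))"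

definition aniso_prox_grad ::
  "('a::euclidean_space \<Rightarrow> ereal) \<Rightarrow> ('a \<Rightarrow> real) \<Rightarrow> ('a \<Rightarrow> ereal) \<Rightarrow> real \<Rightarrow> (nat \<Rightarrow> 'a) \<Rightarrow> (nat \<Rightarrow> 'a) \<Rightarrow> bool" where
  "aniso_prox_grad \<phi> f g c x y \<longleftrightarrow>
     (\<forall>k. y k = x k - c *\<^sub>R egradient (convex_conjugate \<phi>) (gradient f (x k)) \<and>
          x (Suc k) \<in> argmin (\<lambda>z. g z + (c \<star> \<phi>) (z - y k)))"

text \<open>The quotients need not have a limit for the sequences of interest, so the bound is on the
  limit superior. Division is taken in \<^typ>\<open>ereal\<close>, where \<open>0 / 0 = 0\<close> and \<open>c / 0 = \<infinity>\<close> for \<open>c > 0\<close>;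
  hence a sequence that reaches its limit and stays there is admitted, whereas leaving the
  limit again contributes an infinite quotient.\<close>

definition converges_Q_linearly :: "(nat \<Rightarrow> real) \<Rightarrow> real \<Rightarrow> real \<Rightarrow> bool" where
  "converges_Q_linearly a l \<rho> \<longleftrightarrow>
     a \<longlonglongrightarrow> l \<and> limsup (\<lambda>k. ereal \<bar>a (Suc k) - l\<bar> / ereal \<bar>a k - l\<bar>) \<le> ereal \<rho>"

end

theory Submission
  imports Defs
begin

text \<open>
  Write \<open>\<phi> = r\<close> as a real function, \<open>a = 1 / L\<close>, \<open>b = 1 / \<mu>\<close>, and split \<open>G = E + D\<close> into the Moreau
  envelope \<open>E z = inf\<^sub>x g x + a r ((x - z) / a)\<close> and the convex function
  \<open>D z = sup\<^sub>x f x - a r ((x - z) / a)\<close>. For all \<open>x\<close> and \<open>z\<close> the two definitions give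
  \<open>E z \<le> g x + a r ((x - z) / a)\<close> and \<open>f x \<le> D z + a r ((x - z) / a)\<close>. The method makes both
  tight in turn: the backward step picks \<open>x\<^sup>+\<close> with equality in the first at \<open>z = y\<close>
  (\<open>inf_conv_at_resolvent\<close>), and the descent inequality says exactly that the forward step picks
  \<open>y\<^sup>+\<close> with equality in the second at \<open>x = x\<^sup>+\<close> (\<open>inf_deconv_at_forward_step\<close>). Adding the two at
  \<open>z = y\<^sup>+\<close> gives \<open>G y\<^sup>+ \<le> f x\<^sup>+ + g x\<^sup>+\<close>.

  The linear rate comes from the strong convexity of \<open>E\<close>. Infimal convolution adds the scales: if
  \<open>g\<close> lies above a shifted copy of \<open>b \<star> r(- \<cdot>)\<close> that touches it at \<open>x\<^sup>+\<close>, then joint convexity of the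
  perspective of \<open>r\<close> puts \<open>E\<close> above a shifted copy of \<open>(a + b) \<star> r(- \<cdot>)\<close> that touches it at \<open>y\<close>
  (\<open>inf_conv_strong_lower_bound\<close>). Let \<open>\<theta> = a / (a + b) = \<mu> / (\<mu> + L)\<close> and evaluate the bound on
  \<open>f x\<^sup>+\<close> at \<open>(1 - \<theta>) y + \<theta> z\<close>. At this point the argument of \<open>r\<close> coincides with the argument in
  the lower bound on \<open>E z\<close>, since moving by \<open>\<theta> (z - y)\<close> at scale \<open>a\<close> is moving by \<open>z - y\<close> at scale
  \<open>a + b\<close>. With the convexity of \<open>D\<close> this gives
  \<open>f x\<^sup>+ + g x\<^sup>+ \<le> (1 - \<theta>) G y + \<theta> G z\<close> (\<open>backward_step_decrease\<close>), and \<open>z = y\<^sup>\<star>\<close> is the claim.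

  The minimizer of \<open>G\<close> is obtained from one of \<open>f + g\<close>. A tangent of \<open>f\<close> together with the strictly
  convex minorant of \<open>g\<close> at a point with the opposite subgradient makes \<open>f + g\<close> coercive, so it has a
  minimizer \<open>x\<^sup>\<star>\<close>. The forward step \<open>y\<^sup>\<star>\<close> from \<open>x\<^sup>\<star>\<close> is a fixed point where \<open>E\<close> and \<open>D\<close> have
  opposite subgradients. Since the strong lower bound of \<open>E\<close> at \<open>y\<^sup>\<star>\<close> lies strictly above its tangent
  elsewhere, \<open>y\<^sup>\<star>\<close> is the only minimizer.
\<close>

section \<open>Gradients, convexity and subgradients\<close>

lemma gradient_eqI:
  assumes "GDERIV f x :> v"
  shows "gradient f x = v"
  unfolding gradient_def
proof (rule the_equality)
  show "GDERIV f x :> v" by (fact assms)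
next
  fix w assume "GDERIV f x :> w"
  then have "(\<lambda>h. h \<bullet> w) = (\<lambda>h. h \<bullet> v)"
    using assms has_derivative_unique unfolding gderiv_def by blast
  then have "\<And>h. h \<bullet> w = h \<bullet> v" by metis
  then show "w = v"
    by (metis inner_commute vector_eq_rdot)
qed

lemma GDERIV_gradient:
  fixes f :: "'a::euclidean_space \<Rightarrow> real"
  assumes "f differentiable (at x)"
  shows "GDERIV f x :> gradient f x"
proof -
  obtain f' where f': "(f has_derivative f') (at x)"
    using assms unfolding differentiable_def by blast
  define v where "v = (\<Sum>b\<in>Basis. f' b *\<^sub>R b)"
  have lin: "linear f'"
    using f' has_derivative_linear by blast
  have "f' h = h \<bullet> v" for h
  proof -
    have "f' h = f' (\<Sum>b\<in>Basis. (h \<bullet> b) *\<^sub>R b)" by (simp add: euclidean_representation)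
    also have "\<dots> = h \<bullet> v"
      by (simp add: v_def inner_sum_right linear_sum[OF lin] linear_cmul[OF lin] mult.commute)
    finally show ?thesis .
  qed
  then have "f' = (\<lambda>h. h \<bullet> v)" by auto
  then have "GDERIV f x :> v"
    using f' by (simp add: gderiv_def)
  then show ?thesis using gradient_eqI by metis
qed

lemma GDERIV_ray_quotient:
  assumes "GDERIV h x :> v"
  shows "((\<lambda>t. (h (x + t *\<^sub>R d) - h x) / t) \<longlongrightarrow> v \<bullet> d) (at_right 0)"
proof -
  have "((\<lambda>t. h (x + t *\<^sub>R d)) has_derivative (\<lambda>s. (s *\<^sub>R d) \<bullet> v)) (at 0)"
  proof (rule has_derivative_compose[of "\<lambda>t. x + t *\<^sub>R d" "\<lambda>s. s *\<^sub>R d" 0 UNIV h "\<lambda>w. w \<bullet> v"])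
    show "((\<lambda>t. x + t *\<^sub>R d) has_derivative (\<lambda>s. s *\<^sub>R d)) (at 0)"
      by (auto intro!: derivative_eq_intros)
    show "(h has_derivative (\<lambda>w. w \<bullet> v)) (at (x + 0 *\<^sub>R d))"
      using assms by (simp add: gderiv_def)
  qed
  moreover have "(\<lambda>s. (s *\<^sub>R d) \<bullet> v) = (*) (v \<bullet> d)"
    by (auto simp: inner_commute)
  ultimately have "DERIV (\<lambda>t. h (x + t *\<^sub>R d)) 0 :> v \<bullet> d"
    by (simp add: has_field_derivative_def)
  then have "((\<lambda>t. (h (x + t *\<^sub>R d) - h x) / t) \<longlongrightarrow> v \<bullet> d) (at 0)"
    by (simp add: DERIV_def)
  then show ?thesis
    by (rule tendsto_mono[OF at_le, rotated]) simp
qed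

lemma convex_on_above_tangent:
  assumes "convex_on UNIV h" and "GDERIV h x :> v"
  shows "h x + v \<bullet> (y - x) \<le> h y"
proof -
  have "v \<bullet> (y - x) \<le> h y - h x"
  proof (rule tendsto_upperbound[OF GDERIV_ray_quotient[OF assms(2)]])
    show "\<forall>\<^sub>F t in at_right 0. (h (x + t *\<^sub>R (y - x)) - h x) / t \<le> h y - h x"
      unfolding eventually_at_right[OF zero_less_one]
    proof (intro exI[of _ 1] conjI allI impI)
      fix t :: real assume t: "0 < t" "t < 1"
      have "h ((1 - t) *\<^sub>R x + t *\<^sub>R y) \<le> (1 - t) * h x + t * h y"
        using convex_onD[OF assms(1), of t x y] t by simp
      moreover have "(1 - t) *\<^sub>R x + t *\<^sub>R y = x + t *\<^sub>R (y - x)"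
        by (simp add: algebra_simps)
      ultimately have "h (x + t *\<^sub>R (y - x)) - h x \<le> (h y - h x) * t"
        by (simp add: left_diff_distrib right_diff_distrib mult.commute)
      then show "(h (x + t *\<^sub>R (y - x)) - h x) / t \<le> h y - h x"
        using t by (simp add: divide_le_eq)
    qed simp
  qed simp
  then show ?thesis by simp
qed

lemma proper_min_finite:
  assumes "proper_fun g" and min: "\<And>z. g x + ereal (h x) \<le> g z + ereal (h z)"
  obtains \<gamma> where "g x = ereal \<gamma>"
proof -
  obtain z0 where "g z0 < \<infinity>"
    using assms(1) by (auto simp: proper_fun_def edom_def)
  then have "g z0 + ereal (h z0) < \<infinity>" by simp
  then have "g x + ereal (h x) < \<infinity>"
    using min[of z0] by (rule le_less_trans[rotated])
  then have "g x \<noteq> \<infinity>" by auto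
  moreover have "g x \<noteq> -\<infinity>"
    using assms(1) by (auto simp: proper_fun_def dest: spec[of _ x])
  ultimately show ?thesis using that by (cases "g x") auto
qed

text \<open>Fermat's rule for a convex plus a smooth function. The sum is compared with its value at
  \<open>x + t (y - x)\<close>, where convexity bounds the increment of \<open>g\<close> by \<open>t (g y - g x)\<close>; dividing by \<open>t\<close> and
  letting \<open>t \<rightarrow> 0\<close> leaves the linear part of \<open>h\<close>. It is applied with \<open>h\<close> the scaled reference
  function in the backward step, and with \<open>h = f\<close> at the minimizer of \<open>f + g\<close>.\<close>

lemma neg_gradient_in_subdifferential_at_min:
  assumes "proper_fun g" and "convex_fun g" and "GDERIV h x :> v"
    and min: "\<And>z. g x + ereal (h x) \<le> g z + ereal (h z)"
  shows "- v \<in> subdifferential g x"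
  unfolding subdifferential_def
proof (intro CollectI allI)
  fix y
  obtain \<gamma> where \<gamma>: "g x = ereal \<gamma>"
    using proper_min_finite[OF assms(1) min] by blast
  have notm: "g z \<noteq> -\<infinity>" for z
    using assms(1) by (auto simp: proper_fun_def dest: spec[of _ z])
  show "g x + ereal (- v \<bullet> (y - x)) \<le> g y"
  proof (cases "g y")
    case (real \<eta>)
    have "\<gamma> - \<eta> \<le> v \<bullet> (y - x)"
    proof (rule tendsto_lowerbound[OF GDERIV_ray_quotient[OF assms(3)]])
      show "\<forall>\<^sub>F t in at_right 0. \<gamma> - \<eta> \<le> (h (x + t *\<^sub>R (y - x)) - h x) / t"
        unfolding eventually_at_right[OF zero_less_one]
      proof (intro exI[of _ 1] conjI allI impI)
        fix t :: real assume t: "0 < t" "t < 1"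
        let ?z = "x + t *\<^sub>R (y - x)"
        have eq: "(1 - t) *\<^sub>R x + t *\<^sub>R y = ?z"
          by (simp add: algebra_simps)
        have "(1 - t) *\<^sub>R (x, \<gamma>) + t *\<^sub>R (y, \<eta>) \<in> {(x, t::real). g x \<le> ereal t}"
          using assms(2) t \<gamma> real unfolding convex_fun_def by (intro convexD) auto
        then have "g ?z \<le> ereal ((1 - t) * \<gamma> + t * \<eta>)"
          using eq by simp
        then have "g ?z + ereal (h ?z) \<le> ereal ((1 - t) * \<gamma> + t * \<eta>) + ereal (h ?z)"
          by (intro add_right_mono)
        with min[of ?z] have "ereal \<gamma> + ereal (h x) \<le> ereal ((1 - t) * \<gamma> + t * \<eta>) + ereal (h ?z)"
          using \<gamma> by (metis order_trans)
        then show "\<gamma> - \<eta> \<le> (h ?z - h x) / t"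
          using t by (simp add: le_divide_eq algebra_simps)
      qed simp
    qed simp
    then show ?thesis using \<gamma> real by simp
  qed (use notm in auto)
qed

section \<open>Coercivity and existence of minimizers\<close>

text \<open>Strict convexity without any modulus still forces linear growth of the Bregman distance: its
  minimum on a sphere is positive by compactness, and along rays the difference quotients of a convex
  function increase. This single estimate gives the differentiability of the conjugate and
  the coercivity of \<open>f + g\<close>.\<close>

lemma strict_tangent_growth:
  fixes r :: "'a::euclidean_space \<Rightarrow> real"
  assumes "convex_on UNIV r" and strict: "\<And>w. w \<noteq> q \<Longrightarrow> r q + v \<bullet> (w - q) < r w" and "\<epsilon> > 0"
  obtains \<delta> where "\<delta> > 0" "\<And>w. norm w \<ge> \<epsilon> \<Longrightarrow> \<delta> * norm w \<le> r (q + w) - r q - v \<bullet> w"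
proof -
  define \<psi> where "\<psi> w = r (q + w) - r q - v \<bullet> w" for w
  have cr: "continuous_on UNIV r"
    using convex_on_continuous[OF open_UNIV assms(1)] .
  have "continuous_on UNIV (\<lambda>w. r (q + w))"
    by (rule continuous_on_compose2[OF cr]) (auto intro!: continuous_intros)
  then have c\<psi>: "continuous_on UNIV \<psi>"
    unfolding \<psi>_def by (intro continuous_intros)
  have "sphere (0::'a) \<epsilon> \<noteq> {}" "compact (sphere (0::'a) \<epsilon>)"
    using assms(3) by simp_all
  then obtain w0 where w0: "w0 \<in> sphere 0 \<epsilon>" "\<And>w. w \<in> sphere 0 \<epsilon> \<Longrightarrow> \<psi> w0 \<le> \<psi> w"
    using continuous_attains_inf[of "sphere 0 \<epsilon>" \<psi>] continuous_on_subset[OF c\<psi>] by blast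
  have "w0 \<noteq> 0" using w0(1) assms(3) by auto
  then have m: "\<psi> w0 > 0"
    using strict[of "q + w0"] by (simp add: \<psi>_def)
  show ?thesis
  proof (rule that[of "\<psi> w0 / \<epsilon>"])
    show "0 < \<psi> w0 / \<epsilon>" using m assms(3) by simp
    fix w :: 'a assume w: "\<epsilon> \<le> norm w"
    \<comment> \<open>A point \<open>w\<close> outside the ball is compared with its projection \<open>s w\<close> to the sphere.\<close>
    define s where "s = \<epsilon> / norm w"
    have nw: "norm w > 0" using w assms(3) by linarith
    have s: "0 < s" "s \<le> 1"
      using nw w assms(3) by (auto simp: s_def)
    have "s *\<^sub>R w \<in> sphere 0 \<epsilon>"
      using nw assms(3) by (simp add: s_def)
    then have "\<psi> w0 \<le> \<psi> (s *\<^sub>R w)" by (rule w0(2))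
    also have "\<dots> \<le> s * \<psi> w"
    proof -
      have "r ((1 - s) *\<^sub>R q + s *\<^sub>R (q + w)) \<le> (1 - s) * r q + s * r (q + w)"
        using convex_onD[OF assms(1), of s q "q + w"] s by simp
      moreover have "(1 - s) *\<^sub>R q + s *\<^sub>R (q + w) = q + s *\<^sub>R w"
        by (simp add: algebra_simps)
      ultimately show ?thesis by (simp add: \<psi>_def algebra_simps)
    qed
    finally have "\<psi> w0 / \<epsilon> * norm w \<le> \<psi> w"
      using nw assms(3) by (simp add: s_def field_simps)
    then show "\<psi> w0 / \<epsilon> * norm w \<le> r (q + w) - r q - v \<bullet> w"
      by (simp add: \<psi>_def)
  qed
qed

text \<open>A point of strict tangency is recovered from its slope by the gradient of the conjugate. With
  \<open>c = v \<bullet> q - r q\<close>, the value at \<open>v + h\<close> is \<open>c + h \<bullet> q\<close> plus the supremum over \<open>w\<close> of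
  \<open>h \<bullet> w\<close> minus the Bregman distance of \<open>q + w\<close> from \<open>q\<close>. For small \<open>h\<close> the linear growth of that
  distance makes all \<open>w\<close> outside an \<open>\<epsilon>\<close>-ball useless, so the supremum is at most \<open>\<epsilon> \<bar>h\<bar>\<close>.\<close>

lemma conjugate_gradient_at_strict_tangent:
  fixes r :: "'a::euclidean_space \<Rightarrow> real"
  assumes "convex_on UNIV r" and strict: "\<And>w. w \<noteq> q \<Longrightarrow> r q + v \<bullet> (w - q) < r w"
  shows "v \<in> interior (edom (convex_conjugate (\<lambda>x. ereal (r x))))"
    and "egradient (convex_conjugate (\<lambda>x. ereal (r x))) v = q"
proof -
  let ?c = "convex_conjugate (\<lambda>x. ereal (r x))"
  define c where "c = v \<bullet> q - r q"
  \<comment> \<open>Testing the supremum with \<open>q\<close>, which attains it for \<open>h = 0\<close>.\<close>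
  have lower: "ereal (c + h \<bullet> q) \<le> ?c (v + h)" for h
    unfolding convex_conjugate_def by (rule SUP_upper2[of q]) (simp_all add: c_def inner_add_left)
  have upper: "\<exists>\<delta>>0. \<forall>h. norm h < \<delta> \<longrightarrow> ?c (v + h) \<le> ereal (c + h \<bullet> q + \<epsilon> * norm h)" if "\<epsilon> > 0" for \<epsilon>
  proof -
    obtain \<delta> where \<delta>: "\<delta> > 0" "\<And>w. norm w \<ge> \<epsilon> \<Longrightarrow> \<delta> * norm w \<le> r (q + w) - r q - v \<bullet> w"
      using strict_tangent_growth[OF assms \<open>\<epsilon> > 0\<close>] by blast
    have "?c (v + h) \<le> ereal (c + h \<bullet> q + \<epsilon> * norm h)" if h: "norm h < \<delta>" for h
      unfolding convex_conjugate_def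
    proof (rule SUP_least)
      fix x
      define w where "w = x - q"
      have x: "x = q + w" by (simp add: w_def)
      have cs: "h \<bullet> w \<le> norm h * norm w" by (rule norm_cauchy_schwarz)
      have "h \<bullet> w \<le> r (q + w) - r q - v \<bullet> w + \<epsilon> * norm h"
      proof (cases "norm w \<ge> \<epsilon>")
        case True
        have "norm h * norm w \<le> \<delta> * norm w"
          using h by (intro mult_right_mono) auto
        moreover have "0 \<le> \<epsilon> * norm h" using \<open>\<epsilon> > 0\<close> by simp
        ultimately show ?thesis using cs \<delta>(2)[OF True] by linarith
      next
        case False
        have "norm h * norm w \<le> norm h * \<epsilon>"
          using False by (intro mult_left_mono) auto
        moreover have "0 \<le> r (q + w) - r q - v \<bullet> w"
          using strict[of "q + w"] by (cases "w = 0") auto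
        ultimately show ?thesis using cs by (simp add: mult.commute)
      qed
      then show "ereal ((v + h) \<bullet> x) - ereal (r x) \<le> ereal (c + h \<bullet> q + \<epsilon> * norm h)"
        by (simp add: x c_def inner_add_left inner_add_right)
    qed
    then show ?thesis using \<delta>(1) by blast
  qed
  obtain \<delta>1 where \<delta>1: "\<delta>1 > 0" "\<And>h. norm h < \<delta>1 \<Longrightarrow> ?c (v + h) \<le> ereal (c + h \<bullet> q + 1 * norm h)"
    using upper[of 1] by auto
  have "ball v \<delta>1 \<subseteq> edom ?c"
  proof
    fix u assume "u \<in> ball v \<delta>1"
    then have "norm (u - v) < \<delta>1" by (simp add: dist_norm norm_minus_commute)
    from \<delta>1(2)[OF this] show "u \<in> edom ?c"
      by (auto simp: edom_def intro: le_less_trans)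
  qed
  then show "v \<in> interior (edom ?c)"
    using \<delta>1(1) by (meson centre_in_ball interior_maximal open_ball subsetD)
  have cv: "?c v = ereal c"
    using lower[of 0] \<delta>1(2)[of 0] \<delta>1(1) by (simp add: antisym)
  have "((\<lambda>u. real_of_ereal (?c u)) has_derivative (\<lambda>h. h \<bullet> q)) (at v)"
    unfolding has_derivative_at_alt
  proof (intro conjI allI impI)
    show "bounded_linear (\<lambda>h. h \<bullet> q)" by (rule bounded_linear_inner_left)
    fix e :: real assume "e > 0"
    then obtain \<delta> where \<delta>: "\<delta> > 0" "\<And>h. norm h < \<delta> \<Longrightarrow> ?c (v + h) \<le> ereal (c + h \<bullet> q + e * norm h)"
      using upper by blast
    have "norm (real_of_ereal (?c u) - real_of_ereal (?c v) - (u - v) \<bullet> q) \<le> e * norm (u - v)"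
      if u: "norm (u - v) < \<delta>" for u
    proof -
      have 1: "ereal (c + (u - v) \<bullet> q) \<le> ?c u" using lower[of "u - v"] by simp
      have 2: "?c u \<le> ereal (c + (u - v) \<bullet> q + e * norm (u - v))" using \<delta>(2)[OF u] by simp
      from 1 2 obtain s where s: "?c u = ereal s" by (cases "?c u") auto
      show ?thesis using 1 2 by (simp add: s cv)
    qed
    then show "\<exists>d>0. \<forall>u. norm (u - v) < d \<longrightarrow>
        norm (real_of_ereal (?c u) - real_of_ereal (?c v) - (u - v) \<bullet> q) \<le> e * norm (u - v)"
      using \<delta>(1) by blast
  qed
  then show "egradient ?c v = q"
    unfolding egradient_def by (intro gradient_eqI) (simp add: gderiv_def)
qed

text \<open>Lower semicontinuity of \<open>f + g\<close> in the form used for compactness. The sum is rearranged to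
  \<open>g z > c - f z\<close> so that a real number between the two sides separates a lower semicontinuous from a
  continuous function.\<close>

lemma closed_sublevel_continuous_plus_lsc:
  fixes g :: "'a::euclidean_space \<Rightarrow> ereal"
  assumes "continuous_on UNIV f" and "lsc g"
  shows "closed {z. ereal (f z) + g z \<le> ereal c}"
proof -
  have "open {z. ereal (c - f z) < g z}"
    unfolding open_subopen[of "{z. ereal (c - f z) < g z}"]
  proof safe
    fix x assume "ereal (c - f x) < g x"
    then obtain s where s: "c - f x < s" "ereal s < g x"
      using ereal_dense2 by fastforce
    have "ereal s < Liminf (at x) g"
      using s(2) assms(2) by (metis less_le_trans lsc_def)
    then have "\<forall>\<^sub>F z in nhds x. ereal s < g z"
      using s(2) less_LiminfD unfolding eventually_nhds_conv_at by blast
    moreover have "isCont f x"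
      using assms(1) by (simp add: continuous_on_eq_continuous_at)
    then have "(f \<longlongrightarrow> f x) (nhds x)"
      by (simp add: continuous_at_imp_continuous_at_within isCont_def tendsto_at_iff_tendsto_nhds)
    then have "\<forall>\<^sub>F z in nhds x. c - s < f z"
      using s(1) by (intro order_tendstoD(1)) auto
    ultimately have "\<forall>\<^sub>F z in nhds x. ereal (c - f z) < g z"
    proof eventually_elim
      case (elim z)
      then have "ereal (c - f z) < ereal s" by simp
      with elim show ?case by (meson less_trans)
    qed
    then show "\<exists>T. open T \<and> x \<in> T \<and> T \<subseteq> {z. ereal (c - f z) < g z}"
      unfolding eventually_nhds by blast
  qed
  moreover have "(ereal (f z) + g z \<le> ereal c) = (\<not> ereal (c - f z) < g z)" for z
    by (cases "g z") auto
  then have "{z. ereal (f z) + g z \<le> ereal c} = - {z. ereal (c - f z) < g z}"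
    by auto
  ultimately show ?thesis by (simp add: closed_Compl)
qed

text \<open>The sublevel sets through points of one compact sublevel set are closed and have the finite
  intersection property, because finitely many of them contain the point of least value; a common point
  is a minimizer.\<close>

lemma continuous_plus_lsc_attains_inf:
  fixes g :: "'a::euclidean_space \<Rightarrow> ereal"
  assumes "continuous_on UNIV f" and "lsc g" and "proper_fun g"
    and bdd: "bounded {z. ereal (f z) + g z \<le> ereal c}" and ne: "ereal (f x0) + g x0 \<le> ereal c"
  obtains x where "\<And>z. ereal (f x) + g x \<le> ereal (f z) + g z"
proof -
  let ?F = "\<lambda>z. ereal (f z) + g z"
  let ?S = "{z. ?F z \<le> ereal c}"
  have closed: "closed {z. ?F z \<le> ?F w}" if w: "w \<in> ?S" for w
  proof -
    have "g w \<noteq> -\<infinity>" using assms(3) by (auto simp: proper_fun_def dest: spec[of _ w])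
    then obtain s where "?F w = ereal s"
      using w by (cases "g w") auto
    then show ?thesis
      using closed_sublevel_continuous_plus_lsc[OF assms(1,2), of s] by simp
  qed
  have comp: "compact ?S"
    using bdd closed_sublevel_continuous_plus_lsc[OF assms(1,2), of c] compact_eq_bounded_closed by blast
  have "?S \<inter> (\<Inter>w\<in>?S. {z. ?F z \<le> ?F w}) \<noteq> {}"
  proof (rule compact_imp_fip_image[OF comp closed])
    fix I assume I: "finite I" "I \<subseteq> ?S"
    show "?S \<inter> (\<Inter>w\<in>I. {z. ?F z \<le> ?F w}) \<noteq> {}"
    proof (cases "I = {}")
      case True
      then show ?thesis using ne by auto
    next
      case False
      have "Min (?F ` I) \<in> ?F ` I" using I(1) False by (intro Min_in) auto
      then obtain w where w: "Min (?F ` I) = ?F w" "w \<in> I" by (rule imageE)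
      have "?F w \<le> ?F z" if "z \<in> I" for z
        unfolding w(1)[symmetric] using I(1) that by (intro Min_le) auto
      then have "w \<in> ?S \<inter> (\<Inter>w\<in>I. {z. ?F z \<le> ?F w})" using w(2) I(2) by blast
      then show ?thesis by blast
    qed
  qed
  then obtain x where x: "x \<in> ?S" "\<And>w. w \<in> ?S \<Longrightarrow> ?F x \<le> ?F w" by blast
  have "?F x \<le> ?F z" for z
  proof (cases "z \<in> ?S")
    case False
    then have "ereal c \<le> ?F z" by simp
    with x(1) show ?thesis by (meson mem_Collect_eq order_trans)
  qed (rule x(2))
  then show ?thesis using that by blast
qed

text \<open>The tangent of \<open>f\<close> and the minorant of \<open>g\<close> have cancelling slopes \<open>v\<close> and \<open>- v\<close>, so what remains
  of the lower bound on \<open>f + g\<close> is a multiple of a Bregman distance of \<open>r\<close>, which grows linearly. The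
  points \<open>x0\<close> and \<open>xb\<close> may differ: only the slopes have to match.\<close>

lemma coercive_sum_attains_inf:
  fixes r f :: "'a::euclidean_space \<Rightarrow> real"
  assumes r: "convex_on UNIV r" and strict: "\<And>w. w \<noteq> p \<Longrightarrow> r p + v \<bullet> (w - p) < r w"
    and f: "convex_on UNIV f" and fv: "GDERIV f x0 :> v"
    and g: "lsc g" "proper_fun g" and "b > 0"
    and growth: "\<And>x. g xb + ereal (b * (r (inverse b *\<^sub>R (xb - x) + p) - r p)) \<le> g x"
    and \<gamma>: "g xb = ereal \<gamma>"
  obtains x where "\<And>z. ereal (f x) + g x \<le> ereal (f z) + g z"
proof -
  obtain \<delta> where \<delta>: "\<delta> > 0" "\<And>w. norm w \<ge> 1 \<Longrightarrow> \<delta> * norm w \<le> r (p + w) - r p - v \<bullet> w"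
    using strict_tangent_growth[OF r strict zero_less_one] by blast
  define C where "C = f xb + \<gamma>"
  define c where "c = f x0 + \<gamma> + v \<bullet> (xb - x0)"
  have "{z. ereal (f z) + g z \<le> ereal C} \<subseteq> cball xb (max b ((C - c) / \<delta>))"
  proof
    fix z assume "z \<in> {z. ereal (f z) + g z \<le> ereal C}"
    then have z: "ereal (f z) + g z \<le> ereal C" by simp
    define w where "w = inverse b *\<^sub>R (xb - z)"
    have nw: "b * norm w = dist xb z"
      using \<open>b > 0\<close> by (simp add: w_def dist_norm)
    have vw: "b * (v \<bullet> w) = v \<bullet> (xb - z)"
      using \<open>b > 0\<close> by (simp add: w_def flip: mult.assoc)
    show "z \<in> cball xb (max b ((C - c) / \<delta>))"
    proof (cases "norm w \<ge> 1")
      case True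
      have "b * (\<delta> * norm w) \<le> b * (r (p + w) - r p - v \<bullet> w)"
        using \<delta>(2)[OF True] \<open>b > 0\<close> by (intro mult_left_mono) auto
      also have "\<dots> = b * (r (w + p) - r p) - v \<bullet> (xb - z)"
        by (simp add: right_diff_distrib vw add.commute)
      finally have 1: "\<delta> * dist xb z \<le> b * (r (w + p) - r p) - v \<bullet> (xb - z)"
        by (simp add: nw[symmetric] mult.left_commute)
      have "ereal (f z) + ereal (\<gamma> + b * (r (w + p) - r p)) \<le> ereal (f z) + g z"
        using growth[of z] \<gamma> by (intro add_left_mono) (simp add: w_def)
      then have "ereal (f z) + ereal (\<gamma> + b * (r (w + p) - r p)) \<le> ereal C"
        using z by (rule order_trans)
      then have 2: "f z + \<gamma> + b * (r (w + p) - r p) \<le> C" by simp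
      have "f x0 + v \<bullet> (z - x0) \<le> f z" by (rule convex_on_above_tangent[OF f fv])
      with 1 2 have "\<delta> * dist xb z \<le> C - c"
        by (simp add: c_def inner_diff_right)
      then show ?thesis using \<delta>(1) by (simp add: le_divide_eq mult.commute le_max_iff_disj)
    next
      case False
      then have "b * norm w \<le> b * 1" using \<open>b > 0\<close> by (intro mult_left_mono) auto
      then show ?thesis by (simp add: nw le_max_iff_disj)
    qed
  qed
  then have "bounded {z. ereal (f z) + g z \<le> ereal C}"
    using bounded_cball bounded_subset by blast
  moreover have "ereal (f xb) + g xb \<le> ereal C" by (simp add: \<gamma> C_def)
  ultimately show ?thesis
    using continuous_plus_lsc_attains_inf[OF convex_on_continuous[OF open_UNIV f] g] that by blast
qed

section \<open>Reference functions and reflection\<close>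

lemma proper_subgradient_finite:
  assumes "proper_fun g" and "v \<in> subdifferential g x"
  obtains \<gamma> where "g x = ereal \<gamma>"
proof -
  obtain z0 where z0: "g z0 < \<infinity>"
    using assms(1) by (auto simp: proper_fun_def edom_def)
  have "g x + ereal (v \<bullet> (z0 - x)) \<le> g z0"
    using assms(2) by (simp add: subdifferential_def)
  with z0 have "g x \<noteq> \<infinity>" by auto
  moreover have "g x \<noteq> -\<infinity>"
    using assms(1) by (auto simp: proper_fun_def dest: spec[of _ x])
  ultimately show ?thesis using that by (cases "g x") auto
qed

text \<open>All that the argument takes from a reference function: it is a convex real function lying strictly
  above each of its tangents. Essential strict convexity speaks of convex sets of points with
  nonempty subdifferential; the tangents show that this is the whole space.\<close>

lemma reference_function_real:
  assumes "reference_function \<phi>"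
  obtains r where "\<phi> = (\<lambda>x. ereal (r x))" and "convex_on UNIV r"
    and "\<And>x. GDERIV r x :> gradient r x" and "egradient \<phi> = gradient r"
    and "\<And>q w. w \<noteq> q \<Longrightarrow> r q + gradient r q \<bullet> (w - q) < r w"
proof -
  define r where "r = (\<lambda>x. real_of_ereal (\<phi> x))"
  have "\<phi> x = ereal (r x)" for x
  proof -
    have "x \<in> edom \<phi>" "- \<infinity> < \<phi> x"
      using assms by (simp_all add: reference_function_def Gamma0_def proper_fun_def)
    then show ?thesis by (cases "\<phi> x") (simp_all add: edom_def r_def)
  qed
  then have \<phi>: "\<phi> = (\<lambda>x. ereal (r x))" by (rule ext)
  have "convex (epigraph UNIV r)"
    using assms by (auto simp: reference_function_def Gamma0_def convex_fun_def \<phi> epigraph_def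
        case_prod_beta')
  then have conv: "convex_on UNIV r" by (simp add: convex_epigraph)
  have edom: "edom \<phi> = UNIV" by (simp add: edom_def \<phi>)
  have "r differentiable (at x)" for x
    using assms by (simp add: reference_function_def legendre_def essentially_smooth_def edom r_def)
  then have grad: "GDERIV r x :> gradient r x" for x by (rule GDERIV_gradient)
  have tangent: "r q + gradient r q \<bullet> (w - q) \<le> r w" for q w
    using convex_on_above_tangent[OF conv grad] .
  then have "gradient r x \<in> subdifferential \<phi> x" for x
    by (simp add: subdifferential_def \<phi>)
  then have "{x. subdifferential \<phi> x \<noteq> {}} = UNIV" by auto
  then have sc: "strictly_convex_fun_on UNIV \<phi>"
    using assms by (simp add: reference_function_def legendre_def essentially_strictly_convex_def)
  have "r q + gradient r q \<bullet> (w - q) < r w" if "w \<noteq> q" for q w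
  proof -
    have "\<phi> ((1 - 1/2) *\<^sub>R q + (1/2) *\<^sub>R w) < ereal (1 - 1/2) * \<phi> q + ereal (1/2) * \<phi> w"
      using sc[unfolded strictly_convex_fun_on_def, rule_format, of q w "1/2"] that by simp
    then have "2 * r ((1/2) *\<^sub>R q + (1/2) *\<^sub>R w) < r q + r w"
      by (simp add: \<phi>)
    moreover have "r q + gradient r q \<bullet> ((1/2) *\<^sub>R q + (1/2) *\<^sub>R w - q) \<le> r ((1/2) *\<^sub>R q + (1/2) *\<^sub>R w)"
      by (rule tangent)
    moreover have "(1/2) *\<^sub>R q + (1/2) *\<^sub>R w - q = (1/2) *\<^sub>R (w - q)"
      by (simp add: algebra_simps flip: scaleR_add_left)
    ultimately show ?thesis by simp
  qed
  moreover have "egradient \<phi> = gradient r" by (simp add: egradient_def r_def)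
  ultimately show ?thesis using that[OF \<phi> conv grad] by blast
qed

lemma egradient_reflect:
  assumes "GDERIV r (- x) :> v"
  shows "egradient (reflect (\<lambda>x. ereal (r x))) x = - v"
proof -
  have "((\<lambda>z. r (- z)) has_derivative (\<lambda>h. (- h) \<bullet> v)) (at x)"
    using assms
    by (intro has_derivative_compose[of uminus "uminus" x UNIV r "\<lambda>h. h \<bullet> v"])
      (auto simp: gderiv_def intro!: derivative_eq_intros)
  then show ?thesis
    unfolding egradient_def reflect_def by (intro gradient_eqI) (simp add: gderiv_def)
qed

text \<open>Anisotropic strong convexity relative to the reflected function, expressed through \<open>r\<close> and the
  primal point \<open>p\<close> with slope \<open>v\<close> instead of the conjugate. The reflection is tangent at \<open>- p\<close> with slope
  \<open>- v\<close>, hence the gradient of its conjugate at \<open>- v\<close> is \<open>- p\<close>.\<close>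

lemma aniso_strongly_convex_lower_bound:
  fixes r :: "'a::euclidean_space \<Rightarrow> real"
  assumes conv: "convex_on UNIV r" and strict: "\<And>w. w \<noteq> p \<Longrightarrow> r p + v \<bullet> (w - p) < r w"
    and "\<mu> > 0" and g: "aniso_strongly_convex (reflect (\<lambda>x. ereal (r x))) \<mu> g"
    and v: "- v \<in> subdifferential g xb"
  shows "g xb + ereal (1 / \<mu> * (r (\<mu> *\<^sub>R (xb - x) + p) - r p)) \<le> g x"
proof -
  define r' where "r' = (\<lambda>x. r (- x))"
  have refl: "reflect (\<lambda>x. ereal (r x)) = (\<lambda>x. ereal (r' x))"
    by (simp add: reflect_def r'_def fun_eq_iff)
  have "convex_on UNIV r'"
  proof
    fix t :: real and x y :: 'a assume t: "0 < t" "t < 1"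
    show "r' ((1 - t) *\<^sub>R x + t *\<^sub>R y) \<le> (1 - t) * r' x + t * r' y"
      using convex_onD[OF conv, of t "- x" "- y"] t by (simp add: r'_def)
  qed simp
  moreover have "r' (- p) + (- v) \<bullet> (w - (- p)) < r' w" if "w \<noteq> - p" for w
    using strict[of "- w"] that by (simp add: r'_def inner_diff_right inner_add_right minus_equation_iff[of w])
  ultimately have I: "- v \<in> interior (edom (convex_conjugate (\<lambda>x. ereal (r' x))))"
    and E: "egradient (convex_conjugate (\<lambda>x. ereal (r' x))) (- v) = - p"
    using conjugate_gradient_at_strict_tangent by blast+
  have "\<forall>x. g xb + ((1 / \<mu>) \<star> (\<lambda>x. ereal (r' x)))
        (x - xb + inverse \<mu> *\<^sub>R egradient (convex_conjugate (\<lambda>x. ereal (r' x))) (- v))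
      - ((1 / \<mu>) \<star> (\<lambda>x. ereal (r' x)))
        (inverse \<mu> *\<^sub>R egradient (convex_conjugate (\<lambda>x. ereal (r' x))) (- v)) \<le> g x"
    using g v I unfolding aniso_strongly_convex_def refl Let_def by blast
  then have "g xb + ((1 / \<mu>) \<star> reflect (\<lambda>x. ereal (r x))) (x - xb + inverse \<mu> *\<^sub>R (- p))
      - ((1 / \<mu>) \<star> reflect (\<lambda>x. ereal (r x))) (inverse \<mu> *\<^sub>R (- p)) \<le> g x"
    unfolding E refl by blast
  moreover have "- (\<mu> *\<^sub>R (x - xb + inverse \<mu> *\<^sub>R (- p))) = \<mu> *\<^sub>R (xb - x) + p"
    using \<open>\<mu> > 0\<close> by (simp add: algebra_simps)
  ultimately show ?thesis
    using \<open>\<mu> > 0\<close>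
    by (cases "g xb") (simp_all add: episcale_def reflect_def inverse_eq_divide right_diff_distrib add_diff_eq)
qed

section \<open>The Moreau envelope and the deconvolution\<close>

lemma GDERIV_episcale:
  fixes r :: "'a::euclidean_space \<Rightarrow> real"
  assumes "a > 0" and "GDERIV r (inverse a *\<^sub>R (x - y)) :> v"
  shows "GDERIV (\<lambda>z. a * r (inverse a *\<^sub>R (z - y))) x :> v"
proof -
  have "((\<lambda>z. r (inverse a *\<^sub>R (z - y))) has_derivative (\<lambda>h. (inverse a *\<^sub>R h) \<bullet> v)) (at x)"
    using assms(2)
    by (intro has_derivative_compose[of "\<lambda>z. inverse a *\<^sub>R (z - y)" "\<lambda>h. inverse a *\<^sub>R h" x UNIV r "\<lambda>h. h \<bullet> v"])
      (auto simp: gderiv_def intro!: derivative_eq_intros)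
  then have "((\<lambda>z. a * r (inverse a *\<^sub>R (z - y))) has_derivative (\<lambda>h. a * ((inverse a *\<^sub>R h) \<bullet> v))) (at x)"
    by (rule has_derivative_mult_right)
  moreover have "(\<lambda>h. a * ((inverse a *\<^sub>R h) \<bullet> v)) = (\<lambda>h. h \<bullet> v)"
    using assms(1) by (simp flip: mult.assoc)
  ultimately show ?thesis by (simp add: gderiv_def)
qed

lemma inf_conv_reflect:
  fixes r :: "'a::euclidean_space \<Rightarrow> real"
  shows "(g \<box> (a \<star> reflect (\<lambda>x. ereal (r x)))) z
    = (INF x. ereal (a * r (inverse a *\<^sub>R (x - z))) + g x)"
proof -
  have "- (inverse a *\<^sub>R (z - x)) = inverse a *\<^sub>R (x - z)" for x
    by (simp add: scaleR_right_diff_distrib)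
  then show ?thesis by (simp only: inf_conv_def episcale_def reflect_def times_ereal.simps)
qed

lemma inf_conv_le:
  fixes r :: "'a::euclidean_space \<Rightarrow> real"
  shows "(g \<box> (a \<star> reflect (\<lambda>x. ereal (r x)))) z \<le> g x + ereal (a * r (inverse a *\<^sub>R (x - z)))"
  unfolding inf_conv_reflect by (rule INF_lower2[of x]) (simp_all add: add.commute)

lemma inf_deconv_real:
  "((\<lambda>w. ereal (f w)) \<boxminus> (a \<star> (\<lambda>x. ereal (r x)))) z
    = (SUP u. ereal (f (z + u) - a * r (inverse a *\<^sub>R u)))"
  by (simp add: inf_deconv_def episcale_def)

lemma inf_deconv_ge:
  "ereal (f x - a * r (inverse a *\<^sub>R (x - z))) \<le> ((\<lambda>w. ereal (f w)) \<boxminus> (a \<star> (\<lambda>x. ereal (r x)))) z"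
  unfolding inf_deconv_real by (rule SUP_upper2[of "x - z"]) simp_all

text \<open>Adding the subgradient inequality of \<open>g\<close> at \<open>xb\<close> to the scaled tangent inequality of \<open>r\<close> at \<open>p\<close>
  cancels the linear terms, so \<open>xb\<close> attains the infimum defining the envelope at \<open>xb - a p\<close>.\<close>

lemma inf_conv_at_resolvent:
  fixes r :: "'a::euclidean_space \<Rightarrow> real"
  assumes "a > 0" and tangent: "\<And>w. r p + v \<bullet> (w - p) \<le> r w"
    and v: "- v \<in> subdifferential g xb"
  shows "(g \<box> (a \<star> reflect (\<lambda>x. ereal (r x)))) (xb - a *\<^sub>R p) = g xb + ereal (a * r p)"
proof (rule antisym)
  have p: "inverse a *\<^sub>R (xb - (xb - a *\<^sub>R p)) = p" using assms(1) by simp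
  show "(g \<box> (a \<star> reflect (\<lambda>x. ereal (r x)))) (xb - a *\<^sub>R p) \<le> g xb + ereal (a * r p)"
    using inf_conv_le[of g a r "xb - a *\<^sub>R p" xb] unfolding p .
  show "g xb + ereal (a * r p) \<le> (g \<box> (a \<star> reflect (\<lambda>x. ereal (r x)))) (xb - a *\<^sub>R p)"
    unfolding inf_conv_reflect
  proof (rule INF_greatest)
    fix x
    let ?w = "inverse a *\<^sub>R (x - (xb - a *\<^sub>R p))"
    have "a *\<^sub>R (?w - p) = x - xb" using assms(1) by (simp add: algebra_simps)
    then have "a * (v \<bullet> (?w - p)) = v \<bullet> (x - xb)" by (metis inner_scaleR_right)
    moreover have "a * (r p + v \<bullet> (?w - p)) \<le> a * r ?w"
      using tangent[of ?w] assms(1) by (intro mult_left_mono) auto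
    ultimately have le: "a * r p + v \<bullet> (x - xb) \<le> a * r ?w" by (simp add: distrib_left)
    have "g xb + ereal (- v \<bullet> (x - xb)) \<le> g x"
      using v by (simp add: subdifferential_def)
    then have "g xb + ereal (- v \<bullet> (x - xb)) + ereal (a * r p + v \<bullet> (x - xb)) \<le> g x + ereal (a * r ?w)"
      using le by (intro add_mono) simp_all
    then show "g xb + ereal (a * r p) \<le> ereal (a * r ?w) + g x"
      by (cases "g xb"; cases "g x") (simp_all add: add.commute)
  qed
qed

text \<open>The scales add up under infimal convolution. The minorant of \<open>g\<close> contributes \<open>b r(w)\<close> and the
  envelope \<open>a r(u)\<close>; by convexity \<open>a r(u) + b r(w)\<close> is at least \<open>(a + b) r\<close> at the weighted mean of \<open>u\<close> and
  \<open>w\<close>, and in this mean the minimization variable \<open>x\<close> drops out.\<close>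

lemma inf_conv_strong_lower_bound:
  fixes r :: "'a::euclidean_space \<Rightarrow> real"
  assumes "convex_on UNIV r" and "a > 0" and "b > 0"
    and growth: "\<And>x. g xb + ereal (b * (r (inverse b *\<^sub>R (xb - x) + p) - r p)) \<le> g x"
    and \<gamma>: "g xb = ereal \<gamma>"
  shows "ereal (\<gamma> + a * r p + (a + b) * (r (inverse (a + b) *\<^sub>R (xb - a *\<^sub>R p - z) + p) - r p))
    \<le> (g \<box> (a \<star> reflect (\<lambda>x. ereal (r x)))) z"
  unfolding inf_conv_reflect
proof (rule INF_greatest)
  fix x
  define c where "c = a + b"
  have c: "c > 0" using assms by (simp add: c_def)
  let ?u = "inverse a *\<^sub>R (x - z)" and ?w = "inverse b *\<^sub>R (xb - x) + p"
  define t where "t = b / c"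
  have t: "0 \<le> t" "t \<le> 1" "c * t = b" "c * (1 - t) = a"
    using assms(2,3) by (auto simp: t_def c_def field_simps)
  have comb: "inverse c *\<^sub>R (xb - a *\<^sub>R p - z) + p = (1 - t) *\<^sub>R ?u + t *\<^sub>R ?w"
  proof -
    have "c *\<^sub>R ((1 - t) *\<^sub>R ?u + t *\<^sub>R ?w) = a *\<^sub>R ?u + b *\<^sub>R ?w"
      by (simp only: scaleR_add_right scaleR_scaleR t flip: mult.assoc)
    also have "\<dots> = (xb - a *\<^sub>R p - z) + c *\<^sub>R p"
      using assms(2,3) by (simp add: scaleR_add_right c_def scaleR_add_left)
    also have "\<dots> = c *\<^sub>R (inverse c *\<^sub>R (xb - a *\<^sub>R p - z) + p)"
      using c by (simp add: scaleR_add_right)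
    finally show ?thesis using c by simp
  qed
  have "r (inverse c *\<^sub>R (xb - a *\<^sub>R p - z) + p) \<le> (1 - t) * r ?u + t * r ?w"
    unfolding comb using convex_onD[OF assms(1), of t ?u ?w] t(1,2) by simp
  then have "c * r (inverse c *\<^sub>R (xb - a *\<^sub>R p - z) + p) \<le> c * ((1 - t) * r ?u + t * r ?w)"
    using c by (intro mult_left_mono) auto
  also have "\<dots> = a * r ?u + b * r ?w"
    by (simp only: distrib_left t flip: mult.assoc)
  finally have "\<gamma> + a * r p + c * (r (inverse c *\<^sub>R (xb - a *\<^sub>R p - z) + p) - r p)
      \<le> a * r ?u + (\<gamma> + b * (r ?w - r p))"
    by (simp add: c_def algebra_simps)
  then have "ereal (\<gamma> + a * r p + c * (r (inverse c *\<^sub>R (xb - a *\<^sub>R p - z) + p) - r p))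
      \<le> ereal (a * r ?u) + ereal (\<gamma> + b * (r ?w - r p))"
    by simp
  also have "\<dots> \<le> ereal (a * r ?u) + g x"
    using growth[of x] \<gamma> by (intro add_left_mono) simp
  finally show "ereal (\<gamma> + a * r p + (a + b) * (r (inverse (a + b) *\<^sub>R (xb - a *\<^sub>R p - z) + p) - r p))
      \<le> ereal (a * r ?u) + g x" by (simp add: c_def)
qed

text \<open>The anisotropic descent inequality at \<open>xb\<close> is the statement that \<open>x = xb\<close> maximizes
  \<open>f x - a r ((x - y) / a)\<close> for \<open>y = xb - a p\<close>.\<close>

lemma inf_deconv_at_forward_step:
  fixes r :: "'a::euclidean_space \<Rightarrow> real"
  assumes "a > 0" and descent: "\<And>x. f x \<le> f xb + a * (r (inverse a *\<^sub>R (x - xb) + p) - r p)"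
  shows "((\<lambda>w. ereal (f w)) \<boxminus> (a \<star> (\<lambda>x. ereal (r x)))) (xb - a *\<^sub>R p) = ereal (f xb - a * r p)"
proof (rule antisym)
  show "((\<lambda>w. ereal (f w)) \<boxminus> (a \<star> (\<lambda>x. ereal (r x)))) (xb - a *\<^sub>R p) \<le> ereal (f xb - a * r p)"
    unfolding inf_deconv_real
  proof (rule SUP_least)
    fix u
    have "inverse a *\<^sub>R (xb - a *\<^sub>R p + u - xb) + p = inverse a *\<^sub>R u"
      using assms(1) by (simp add: algebra_simps)
    then show "ereal (f (xb - a *\<^sub>R p + u) - a * r (inverse a *\<^sub>R u)) \<le> ereal (f xb - a * r p)"
      using descent[of "xb - a *\<^sub>R p + u"] by (simp add: right_diff_distrib)
  qed
  show "ereal (f xb - a * r p) \<le> ((\<lambda>w. ereal (f w)) \<boxminus> (a \<star> (\<lambda>x. ereal (r x)))) (xb - a *\<^sub>R p)"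
    using inf_deconv_ge[of f xb a r "xb - a *\<^sub>R p"] assms(1) by simp
qed

text \<open>As a supremum of translates of \<open>f\<close> minus constants, the deconvolution inherits convexity from \<open>f\<close>.
  The bounds by real numbers avoid infinite values in the convex combination.\<close>

lemma inf_deconv_convex:
  assumes "convex_on UNIV f" and t: "0 \<le> t" "t \<le> 1"
    and y: "((\<lambda>w. ereal (f w)) \<boxminus> h) y \<le> ereal d" and z: "((\<lambda>w. ereal (f w)) \<boxminus> h) z \<le> ereal e"
    and h: "h = a \<star> (\<lambda>x. ereal (r x))"
  shows "((\<lambda>w. ereal (f w)) \<boxminus> h) ((1 - t) *\<^sub>R y + t *\<^sub>R z) \<le> ereal ((1 - t) * d + t * e)"
  unfolding h inf_deconv_real
proof (rule SUP_least)
  fix u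
  let ?s = "a * r (inverse a *\<^sub>R u)"
  have "f (y + u) - ?s \<le> d" "f (z + u) - ?s \<le> e"
    using y z unfolding h inf_deconv_real SUP_le_iff by auto
  then have "(1 - t) * (f (y + u) - ?s) + t * (f (z + u) - ?s) \<le> (1 - t) * d + t * e"
    using t by (intro add_mono mult_left_mono) auto
  moreover have "f ((1 - t) *\<^sub>R (y + u) + t *\<^sub>R (z + u)) \<le> (1 - t) * f (y + u) + t * f (z + u)"
    using convex_onD[OF assms(1), of t "y + u" "z + u"] t by simp
  moreover have "(1 - t) *\<^sub>R (y + u) + t *\<^sub>R (z + u) = (1 - t) *\<^sub>R y + t *\<^sub>R z + u"
    by (simp add: algebra_simps)
  ultimately show "ereal (f ((1 - t) *\<^sub>R y + t *\<^sub>R z + u) - ?s) \<le> ereal ((1 - t) * d + t * e)"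
    by (simp add: algebra_simps)
qed

section \<open>The forward and the backward step\<close>

text \<open>The range condition in the descent property provides a point at which \<open>r\<close> has the slope
  \<open>gradient f x\<close>, and strictness identifies it with the point that the method computes from the
  conjugate. The forward step is thereby described by \<open>r\<close> alone.\<close>

lemma forward_step_direction:
  fixes r :: "'a::euclidean_space \<Rightarrow> real"
  assumes r: "convex_on UNIV r" and grad: "egradient (\<lambda>x. ereal (r x)) = gradient r"
    and strict: "\<And>q w. w \<noteq> q \<Longrightarrow> r q + gradient r q \<bullet> (w - q) < r w"
    and "L > 0" and descent: "aniso_descent (\<lambda>x. ereal (r x)) L f"
  defines "q \<equiv> \<lambda>x. egradient (convex_conjugate (\<lambda>x. ereal (r x))) (gradient f x)"
  shows "gradient r (q x) = gradient f x"
    and "f z \<le> f x + 1 / L * (r (inverse (1 / L) *\<^sub>R (z - x) + q x) - r (q x))"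
proof -
  obtain p where p: "gradient f x = gradient r p"
    using descent unfolding aniso_descent_def grad by blast
  then show "gradient r (q x) = gradient f x"
    using conjugate_gradient_at_strict_tangent(2)[OF r, of p "gradient r p"] strict
    by (simp add: q_def)
  have "ereal (f z) \<le> ereal (f x) + ((1 / L) \<star> (\<lambda>x. ereal (r x))) (z - x + inverse L *\<^sub>R q x)
      - ((1 / L) \<star> (\<lambda>x. ereal (r x))) (inverse L *\<^sub>R q x)"
    using descent unfolding aniso_descent_def Let_def q_def by blast
  then show "f z \<le> f x + 1 / L * (r (inverse (1 / L) *\<^sub>R (z - x) + q x) - r (q x))"
    using \<open>L > 0\<close>
    by (simp add: episcale_def inverse_eq_divide scaleR_add_right right_diff_distrib add_diff_eq)
qed

lemma backward_step_subgradient: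
  fixes r :: "'a::euclidean_space \<Rightarrow> real"
  assumes "a > 0" and "proper_fun g" and "convex_fun g"
    and x: "x \<in> argmin (\<lambda>z. g z + (a \<star> (\<lambda>x. ereal (r x))) (z - y))"
    and grad: "GDERIV r (inverse a *\<^sub>R (x - y)) :> v"
  shows "- v \<in> subdifferential g x"
proof (rule neg_gradient_in_subdifferential_at_min[OF assms(2,3) GDERIV_episcale[OF \<open>a > 0\<close> grad]])
  fix z
  show "g x + ereal (a * r (inverse a *\<^sub>R (x - y))) \<le> g z + ereal (a * r (inverse a *\<^sub>R (z - y)))"
    using x by (simp add: argmin_def is_arg_min_def episcale_def not_less)
qed

section \<open>The contraction\<close>

text \<open>The estimate behind the rate, here for \<open>y = xb - a p\<close> and an arbitrary comparison point \<open>z\<close>. The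
  factor \<open>a / (a + b)\<close> is the one for which the two occurrences of \<open>r\<close>, in the upper bound on \<open>f xb\<close> and
  in the lower bound on the envelope at \<open>z\<close>, have the same argument.\<close>

lemma backward_step_decrease:
  fixes r :: "'a::euclidean_space \<Rightarrow> real"
  assumes r: "convex_on UNIV r" and f: "convex_on UNIV f" and "a > 0" and "b > 0"
    and growth: "\<And>x. g xb + ereal (b * (r (inverse b *\<^sub>R (xb - x) + p) - r p)) \<le> g x"
    and \<gamma>: "g xb = ereal \<gamma>"
    and Dy: "((\<lambda>w. ereal (f w)) \<boxminus> (a \<star> (\<lambda>x. ereal (r x)))) (xb - a *\<^sub>R p) \<le> ereal d"
    and Dz: "((\<lambda>w. ereal (f w)) \<boxminus> (a \<star> (\<lambda>x. ereal (r x)))) z \<le> ereal e"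
    and Ez: "(g \<box> (a \<star> reflect (\<lambda>x. ereal (r x)))) z \<le> ereal m"
  shows "f xb + \<gamma> \<le> (1 - a / (a + b)) * (\<gamma> + a * r p + d) + a / (a + b) * (m + e)"
proof -
  let ?y = "xb - a *\<^sub>R p"
  define t where "t = a / (a + b)"
  have t: "0 \<le> t" "t \<le> 1" "t * (a + b) = a" "inverse a * t = inverse (a + b)"
    using assms(3,4) by (auto simp: t_def field_simps)
  define w where "w = inverse (a + b) *\<^sub>R (?y - z) + p"
  have w: "inverse a *\<^sub>R (xb - ((1 - t) *\<^sub>R ?y + t *\<^sub>R z)) = w"
  proof -
    have "xb - ((1 - t) *\<^sub>R ?y + t *\<^sub>R z) = a *\<^sub>R p + t *\<^sub>R (?y - z)"
      by (simp add: algebra_simps)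
    then show ?thesis
      using t(4) assms(3) by (simp add: w_def scaleR_add_right)
  qed
  have "ereal (f xb - a * r w) \<le> ereal ((1 - t) * d + t * e)"
    using inf_deconv_ge[of f xb a r "(1 - t) *\<^sub>R ?y + t *\<^sub>R z"]
      inf_deconv_convex[OF f t(1,2) Dy Dz refl] unfolding w by (rule order_trans)
  then have 1: "f xb \<le> (1 - t) * d + t * e + a * r w" by simp
  have "ereal (\<gamma> + a * r p + (a + b) * (r w - r p)) \<le> ereal m"
    using inf_conv_strong_lower_bound[OF r assms(3,4) growth \<gamma>, of z] Ez
    unfolding w_def by (rule order_trans)
  then have "t * (\<gamma> + a * r p + (a + b) * (r w - r p)) \<le> t * m"
    using t(1) by (intro mult_left_mono) auto
  moreover have "t * ((a + b) * (r w - r p)) = a * (r w - r p)"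
    using t(3) by (simp flip: mult.assoc)
  ultimately have "a * r w \<le> t * m - t * (\<gamma> + a * r p) + a * r p"
    by (simp add: distrib_left right_diff_distrib)
  with 1 show ?thesis unfolding t_def[symmetric] by (simp add: algebra_simps)
qed

lemma converges_Q_linearly_contraction:
  assumes lower: "\<And>k. l \<le> a k" and contr: "\<And>k. a (Suc k) - l \<le> \<rho> * (a k - l)"
    and \<rho>: "0 \<le> \<rho>" "\<rho> < 1"
  shows "converges_Q_linearly a l \<rho>"
  unfolding converges_Q_linearly_def
proof
  have bound: "a k - l \<le> \<rho> ^ k * (a 0 - l)" for k
  proof (induction k)
    case (Suc k)
    have "a (Suc k) - l \<le> \<rho> * (\<rho> ^ k * (a 0 - l))"
      using contr[of k] mult_left_mono[OF Suc \<rho>(1)] by linarith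
    then show ?case by simp
  qed simp
  have "(\<lambda>k. \<rho> ^ k * (a 0 - l)) \<longlonglongrightarrow> 0 * (a 0 - l)"
    using \<rho> by (intro tendsto_mult tendsto_const LIMSEQ_realpow_zero) auto
  then have lim: "(\<lambda>k. \<rho> ^ k * (a 0 - l)) \<longlonglongrightarrow> 0" by simp
  have "(\<lambda>k. a k - l) \<longlonglongrightarrow> 0"
  proof (rule tendsto_sandwich[OF _ _ tendsto_const lim])
    show "\<forall>\<^sub>F k in sequentially. 0 \<le> a k - l"
      using lower by simp
    show "\<forall>\<^sub>F k in sequentially. a k - l \<le> \<rho> ^ k * (a 0 - l)"
      by (intro always_eventually allI bound)
  qed
  then show "a \<longlonglongrightarrow> l" by (simp add: LIM_zero_iff)
  have "ereal \<bar>a (Suc k) - l\<bar> / ereal \<bar>a k - l\<bar> \<le> ereal \<rho>" for k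
  proof (cases "a k = l")
    case True
    \<comment> \<open>The limit is reached and kept, so the quotient is \<open>0 / 0 = 0\<close>.\<close>
    then have "a (Suc k) = l" using contr[of k] lower[of "Suc k"] by simp
    then show ?thesis using \<rho>(1) by simp
  next
    case False
    then have "a k - l > 0" using lower[of k] by simp
    then show ?thesis
      using contr[of k] lower[of "Suc k"] by (simp add: divide_le_eq)
  qed
  then show "limsup (\<lambda>k. ereal \<bar>a (Suc k) - l\<bar> / ereal \<bar>a k - l\<bar>) \<le> ereal \<rho>"
    by (intro Limsup_bounded) auto
qed

theorem proposition6p9:
  fixes \<phi> :: "real ^ 'n \<Rightarrow> ereal"
    and f :: "real ^ 'n \<Rightarrow> real"
    and g G :: "real ^ 'n \<Rightarrow> ereal"
    and L \<mu> lam :: real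
    and x y :: "nat \<Rightarrow> real ^ 'n"
  assumes "reference_function \<phi>"
    and "C1_fun f"
    and "L > 0" and "aniso_descent \<phi> L f"
    and "proper_fun g" and "lsc g"
    and "(INF z. ereal (f z) + g z) > -\<infinity>"
    and "edom (convex_conjugate g) \<inter> interior (edom (convex_conjugate (reflect \<phi>))) \<noteq> {}"
    and "convex_on UNIV f"
    and "\<mu> > 0" and "aniso_strongly_convex (reflect \<phi>) \<mu> g"
    and "lam = 1 / L"
    and "aniso_prox_grad \<phi> f g lam x y"
    and "G = (\<lambda>z. (g \<box> (lam \<star> reflect \<phi>)) z + ((\<lambda>w. ereal (f w)) \<boxminus> (lam \<star> \<phi>)) z)"
  shows "\<exists>ystar. argmin G = {ystar} \<and>
           \<bar>G ystar\<bar> \<noteq> \<infinity> \<and> (\<forall>k. \<bar>G (y k)\<bar> \<noteq> \<infinity>) \<and>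
           converges_Q_linearly (\<lambda>k. real_of_ereal (G (y k))) (real_of_ereal (G ystar)) (1 - \<mu> / (\<mu> + L)) \<and>
           (\<forall>k. G (y (Suc k)) - G ystar \<le> ereal (1 - \<mu> / (\<mu> + L)) * (G (y k) - G ystar))"
proof -
  obtain r where \<phi>: "\<phi> = (\<lambda>x. ereal (r x))" and r: "convex_on UNIV r"
    and rgrad: "\<And>x. GDERIV r x :> gradient r x" and egrad: "egradient \<phi> = gradient r"
    and strict: "\<And>q w. w \<noteq> q \<Longrightarrow> r q + gradient r q \<bullet> (w - q) < r w"
    using reference_function_real[OF assms(1)] by blast
  note f = \<open>convex_on UNIV f\<close> and proper = \<open>proper_fun g\<close> and strong = assms(11)[unfolded \<phi>]
  have convg: "convex_fun g" and rangeg: "range (egradient (reflect \<phi>)) \<subseteq> (\<Union>x. subdifferential g x)"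
    using assms(11) by (auto simp: aniso_strongly_convex_def Gamma0_def)
  have fgrad: "GDERIV f x :> gradient f x" for x
    using assms(2) by (intro GDERIV_gradient) (simp add: C1_fun_def)
  have tangent: "r q + gradient r q \<bullet> (w - q) \<le> r w" for q w
    using strict[of w q] by (cases "w = q") auto

  define a where "a = 1 / L"
  define b where "b = 1 / \<mu>"
  define \<theta> where "\<theta> = a / (a + b)"
  define q where "q = (\<lambda>x. egradient (convex_conjugate \<phi>) (gradient f x))"
  have a: "a > 0" and b: "b > 0" and lam: "lam = a"
    using assms(3,10,12) by (auto simp: a_def b_def)
  have \<theta>: "0 < \<theta>" "\<theta> \<le> 1" "\<theta> = \<mu> / (\<mu> + L)"
    using a b assms(3,10) by (auto simp: \<theta>_def a_def b_def divide_simps)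
  define E where "E = g \<box> (a \<star> reflect (\<lambda>x. ereal (r x)))"
  define D where "D = (\<lambda>w. ereal (f w)) \<boxminus> (a \<star> (\<lambda>x. ereal (r x)))"
  have G: "G z = E z + D z" for z
    by (simp add: assms(14) E_def D_def lam \<phi>)

  have growth: "g xb + ereal (b * (r (inverse b *\<^sub>R (xb - x) + p) - r p)) \<le> g x"
    if "- gradient r p \<in> subdifferential g xb" for xb p x
    using aniso_strongly_convex_lower_bound[OF r strict \<open>\<mu> > 0\<close> strong that, of x]
    by (simp add: b_def inverse_eq_divide)
  have q: "gradient r (q x) = gradient f x" for x
    using forward_step_direction(1)[OF r egrad[unfolded \<phi>] strict assms(3) assms(4)[unfolded \<phi>]]
    by (simp add: q_def \<phi>)
  have descent: "f z \<le> f x + a * (r (inverse a *\<^sub>R (z - x) + q x) - r (q x))" for x z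
    using forward_step_direction(2)[OF r egrad[unfolded \<phi>] strict assms(3) assms(4)[unfolded \<phi>]]
    unfolding q_def \<phi> a_def .
  \<comment> \<open>Each part of \<open>G\<close> is computed only where its extremum is attained: \<open>E\<close> where a backward step
    starts, \<open>D\<close> where a forward step ends.\<close>
  have E_at: "E (xb - a *\<^sub>R p) = g xb + ereal (a * r p)"
    if "- gradient r p \<in> subdifferential g xb" for xb p
    unfolding E_def by (rule inf_conv_at_resolvent[OF a tangent that])
  have D_at: "D (x - a *\<^sub>R q x) = ereal (f x - a * r (q x))" for x
    unfolding D_def by (rule inf_deconv_at_forward_step[OF a descent])

  \<comment> \<open>Coercivity: the range condition of strong convexity yields a point where \<open>g\<close> has the slope opposite
    to that of \<open>f\<close> at the origin; any other point would do in place of the origin.\<close>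
  obtain xs where xs: "\<And>z. ereal (f xs) + g xs \<le> ereal (f z) + g z"
  proof -
    have "egradient (reflect \<phi>) (- q 0) = - gradient f 0"
      using egradient_reflect[of r "- q 0"] rgrad[of "q 0"] q[of 0] by (simp add: \<phi>)
    then have "- gradient f 0 \<in> (\<Union>x. subdifferential g x)"
      using rangeg rangeI[of "egradient (reflect \<phi>)" "- q 0"] by auto
    then obtain xb where "- gradient f 0 \<in> subdifferential g xb" by blast
    then have xb: "- gradient r (q 0) \<in> subdifferential g xb" by (simp add: q)
    obtain \<gamma> where \<gamma>: "g xb = ereal \<gamma>"
      using proper_subgradient_finite[OF proper xb] by blast
    show ?thesis
      using coercive_sum_attains_inf[OF r strict f _ assms(6) proper b growth[OF xb] \<gamma>, of 0]
        fgrad[of 0] that by (simp add: q) blast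
  qed
  have sub_xs: "- gradient r (q xs) \<in> subdifferential g xs"
    unfolding q
  proof (rule neg_gradient_in_subdifferential_at_min[OF proper convg fgrad])
    show "g xs + ereal (f xs) \<le> g z + ereal (f z)" for z
      using xs[of z] by (simp add: add.commute)
  qed
  obtain \<gamma>s where \<gamma>s: "g xs = ereal \<gamma>s"
    using proper_subgradient_finite[OF proper sub_xs] by blast
  define ys where "ys = xs - a *\<^sub>R q xs"
  define es where "es = \<gamma>s + a * r (q xs)"
  define ds where "ds = f xs - a * r (q xs)"
  have E_ys: "E ys = ereal es" and D_ys: "D ys = ereal ds"
    using E_at[OF sub_xs] D_at[of xs] by (simp_all add: ys_def \<gamma>s es_def ds_def)
  have G_ys: "G ys = ereal (es + ds)" by (simp add: G E_ys D_ys)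

  \<comment> \<open>At \<open>ys\<close> the slopes \<open>- gradient f xs\<close> of \<open>E\<close> and \<open>gradient f xs\<close> of \<open>D\<close> cancel. Only the bound for \<open>E\<close> is
    strict, and \<open>D z\<close> may be infinite.\<close>
  have unique: "G ys < G z" if "z \<noteq> ys" for z
  proof -
    let ?v = "gradient f xs"
    define w where "w = inverse (a + b) *\<^sub>R (ys - z)"
    have "w \<noteq> 0" using that a b by (simp add: w_def)
    then have "?v \<bullet> w < r (w + q xs) - r (q xs)"
      using strict[of "w + q xs" "q xs"] by (simp add: q)
    then have "(a + b) * (?v \<bullet> w) < (a + b) * (r (w + q xs) - r (q xs))"
      using a b by simp
    moreover have "(a + b) * (?v \<bullet> w) = ?v \<bullet> (ys - z)"
      using a b by (simp add: w_def flip: mult.assoc)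
    ultimately have lt: "es + ds < es + (a + b) * (r (w + q xs) - r (q xs)) + (ds + ?v \<bullet> (z - ys))"
      by (simp add: inner_diff_right)
    have Ez: "ereal (es + (a + b) * (r (w + q xs) - r (q xs))) \<le> E z"
      using inf_conv_strong_lower_bound[where z = z, OF r a b growth[OF sub_xs] \<gamma>s]
      by (simp add: E_def es_def w_def ys_def)
    have Dz: "ereal (ds + ?v \<bullet> (z - ys)) \<le> D z"
    proof -
      have "f xs + ?v \<bullet> (z + a *\<^sub>R q xs - xs) \<le> f (z + a *\<^sub>R q xs)"
        by (rule convex_on_above_tangent[OF f fgrad])
      then have "ereal (ds + ?v \<bullet> (z - ys))
          \<le> ereal (f (z + a *\<^sub>R q xs) - a * r (inverse a *\<^sub>R (z + a *\<^sub>R q xs - z)))"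
        using a by (simp add: ds_def ys_def algebra_simps)
      then show ?thesis
        unfolding D_def using inf_deconv_ge order_trans by blast
    qed
    have "ereal (es + (a + b) * (r (w + q xs) - r (q xs)) + (ds + ?v \<bullet> (z - ys))) \<le> G z"
      using add_mono[OF Ez Dz] by (simp add: G)
    with lt show ?thesis unfolding G_ys by (meson less_ereal.simps(1) less_le_trans)
  qed
  then have min: "G ys \<le> G z" for z by (cases "z = ys") (auto intro: less_imp_le)
  have argmin: "argmin G = {ys}"
    using unique min unfolding argmin_def is_arg_min_def by (auto simp: not_less) (metis not_less)

  have y: "y k = x k - a *\<^sub>R q (x k)"
    and x: "x (Suc k) \<in> argmin (\<lambda>z. g z + (a \<star> \<phi>) (z - y k))" for k
    using assms(13) unfolding aniso_prox_grad_def q_def lam by blast+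
  have step: "\<exists>e d e'. E (y k) = ereal e \<and> D (y k) = ereal d \<and> G (y (Suc k)) = ereal e' \<and>
      e' \<le> (1 - \<theta>) * (e + d) + \<theta> * (es + ds)" for k
  proof -
    define p where "p = inverse a *\<^sub>R (x (Suc k) - y k)"
    have yk: "y k = x (Suc k) - a *\<^sub>R p" using a by (simp add: p_def)
    have sub: "- gradient r p \<in> subdifferential g (x (Suc k))"
      using backward_step_subgradient[OF a proper convg x[of k, unfolded \<phi>] rgrad] by (simp add: p_def)
    obtain \<gamma> where \<gamma>: "g (x (Suc k)) = ereal \<gamma>"
      using proper_subgradient_finite[OF proper sub] by blast
    have Ek: "E (y k) = ereal (\<gamma> + a * r p)" unfolding yk E_at[OF sub] by (simp add: \<gamma>)
    have Dk: "D (y k) = ereal (f (x k) - a * r (q (x k)))" unfolding y by (rule D_at)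
    have dec: "f (x (Suc k)) + \<gamma> \<le> (1 - \<theta>) * (\<gamma> + a * r p + (f (x k) - a * r (q (x k)))) + \<theta> * (es + ds)"
      unfolding \<theta>_def
      by (rule backward_step_decrease[OF r f a b growth[OF sub] \<gamma>, where z = ys])
        (use Dk D_ys E_ys in \<open>simp_all add: D_def E_def yk\<close>)
    \<comment> \<open>The value of \<open>E\<close> at the new forward step is only bounded from above, by testing with \<open>x (Suc k)\<close>;
      the term \<open>a r (q (x (Suc k)))\<close> then cancels against the one in \<open>D\<close>.\<close>
    have "inverse a *\<^sub>R (x (Suc k) - y (Suc k)) = q (x (Suc k))"
      using a by (simp add: y)
    then have "E (y (Suc k)) \<le> ereal (\<gamma> + a * r (q (x (Suc k))))"
      using inf_conv_le[of g a r "y (Suc k)" "x (Suc k)"] by (simp add: E_def \<gamma>)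
    moreover have "D (y (Suc k)) = ereal (f (x (Suc k)) - a * r (q (x (Suc k))))"
      unfolding y by (rule D_at)
    ultimately have "G (y (Suc k)) \<le> ereal (f (x (Suc k)) + \<gamma>)"
      unfolding G by (cases "E (y (Suc k))") auto
    moreover have "ereal (es + ds) \<le> G (y (Suc k))" using min G_ys by metis
    ultimately obtain e' where "G (y (Suc k)) = ereal e'" "e' \<le> f (x (Suc k)) + \<gamma>"
      by (cases "G (y (Suc k))") auto
    with Ek Dk dec show ?thesis by (meson order_trans)
  qed
  define A where "A k = real_of_ereal (G (y k))" for k
  have Gy: "G (y k) = ereal (A k)" for k
    using step[of k] by (auto simp: A_def G)
  have lower: "es + ds \<le> A k" for k
    using min[of "y k"] by (simp add: G_ys Gy)
  have contr: "A (Suc k) - (es + ds) \<le> (1 - \<theta>) * (A k - (es + ds))" for k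
  proof -
    obtain e d e' where ed: "E (y k) = ereal e" "D (y k) = ereal d" "G (y (Suc k)) = ereal e'"
      "e' \<le> (1 - \<theta>) * (e + d) + \<theta> * (es + ds)" using step by blast
    have "A k = e + d" "A (Suc k) = e'" using ed(1-3) by (simp_all add: A_def G)
    with ed(4) show ?thesis by (simp add: algebra_simps)
  qed
  have "converges_Q_linearly A (es + ds) (1 - \<theta>)"
    using \<theta>(1,2) by (intro converges_Q_linearly_contraction lower contr) auto
  moreover have "G (y (Suc k)) - G ys \<le> ereal (1 - \<theta>) * (G (y k) - G ys)" for k
    using contr[of k] by (simp add: Gy G_ys)
  ultimately show ?thesis
    using argmin unfolding \<theta>(3)
    by (intro exI[of _ ys]) (simp add: Gy G_ys)
qed

end
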